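(* Let $\varepsilon > 0$. Then for every prime $q$ sufficiently large with respect to $1/\varepsilon$, and every integer $a$ with $(a,q)=1$, there exist positive integers $n, m \leq q^{5/2+\varepsilon}$ with $n \equiv m \equiv a \pmod{q}$ such that $\lambda(n) = -1$ and $\lambda(m) = 1$.
   Context: $\lambda$ denotes the Liouville function: $\lambda(n) = (-1)^{\Omega(n)}$, where $\Omega(n)$ is the number of prime factors of $n$ counted with multiplicity. *)

theory Defs
  imports Complex_Main "HOL-Number_Theory.Number_Theory"
begin

(* Only meaningful for n > 0; since prime_factorization 0 = {#}, the value at 0 is 1 by convention. *)
definition liouville_lambda :: "nat \<Rightarrow> int" where
  "liouville_lambda n = (-1) ^ size (prime_factorization n)"

end

theory Submission
  imports Defs "HOL-Library.Discrete_Functions"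
begin

text \<open>Thue's lemma writes any residue class \<open>y\<close> as \<open>\<plusminus>u/v\<close> with \<open>u, v \<le> sqrt q\<close>.
Let \<open>p \<le> q + 4\<close> be a prime that is a square \<open>y\<^sup>2\<close> modulo \<open>q\<close>, and let \<open>w\<close> be the
residue of \<open>p v\<close>. Then \<open>p v \<equiv> w\<close> and \<open>w v \<equiv> u\<^sup>2\<close> modulo \<open>q\<close>, all four numbers being \<open>O(q\<^sup>3\<^sup>/\<^sup>2)\<close>,
and \<open>\<lambda>\<close> cannot agree on both pairs, since that would give
\<open>1 = \<lambda>(w) \<lambda>(v) = \<lambda>(p) \<lambda>(v)\<^sup>2 = -1\<close>. Multiplying the pair on which \<open>\<lambda>\<close> differs by
a \<open>b < q\<close> moves it into the class of \<open>a\<close>. By quadratic reciprocity, \<open>p\<close> may be any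
prime factor of \<open>q - 4\<close> or \<open>q + 4\<close>, according to whether \<open>q\<close> is 1 or 3 modulo 4.\<close>

lemma liouville_lambda_mult:
  assumes "m > 0" "n > 0"
  shows "liouville_lambda (m * n) = liouville_lambda m * liouville_lambda n"
  using assms by (simp add: liouville_lambda_def prime_factorization_mult power_add)

lemma liouville_lambda_prime: "prime p \<Longrightarrow> liouville_lambda p = -1"
  by (simp add: liouville_lambda_def prime_factorization_prime)

lemma liouville_lambda_cases: "liouville_lambda n = 1 \<or> liouville_lambda n = -1"
  by (simp add: liouville_lambda_def minus_one_power_iff)

lemma liouville_lambda_square: "liouville_lambda n * liouville_lambda n = 1"
  using liouville_lambda_cases[of n] by auto

text \<open>Pigeonhole: more than \<open>q\<close> pairs \<open>(i, j)\<close> with entries up to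
  the integer square root of \<open>q\<close> share the \<open>q\<close> residues of
  \<open>y * i - j\<close>. Two pairs collide, and their differences have ratio \<open>y\<close>
  modulo \<open>q\<close>. Squaring discards the signs, so \<open>u\<close> and \<open>v\<close> can
  be natural numbers.\<close>

lemma thue_squares:
  fixes q :: nat and y :: int
  assumes q: "prime q" and y: "coprime y (int q)"
  obtains u v :: nat where "u > 0" "v > 0" "u * u \<le> q" "v * v \<le> q"
    "[y\<^sup>2 * (int v)\<^sup>2 = (int u)\<^sup>2] (mod int q)"
proof -
  have q1: "q > 1" using q prime_gt_1_nat by blast
  define K where "K = floor_sqrt q"
  have KK: "K * K \<le> q" using floor_sqrt_power2_le[of q] by (simp add: K_def power2_eq_square)
  have KS: "q < Suc K * Suc K" using Suc_floor_sqrt_power2_gt[of q] by (simp add: K_def power2_eq_square)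
  have Kq: "K < q"
  proof (rule ccontr)
    assume "\<not> K < q"
    then have "q * q \<le> K * K" by (simp add: mult_le_mono)
    with KK q1 show False
      by (metis leD less_le_trans mult.right_neutral mult_less_cancel1 order_less_trans zero_less_one)
  qed
  define g where "g = (\<lambda>(i::nat, j::nat). (y * int i - int j) mod int q)"
  define A where "A = {0..K} \<times> {0..K}"
  have "\<not> inj_on g A"
  proof
    assume "inj_on g A"
    moreover have "g ` A \<subseteq> {0..<int q}" using q1 by (auto simp: g_def)
    ultimately have "card A \<le> card {0..<int q}" by (intro card_inj_on_le) auto
    then show False using KS by (simp add: A_def)
  qed
  then obtain i j i' j' where ij: "(i, j) \<in> A" "(i', j') \<in> A" "(i, j) \<noteq> (i', j')" "g (i, j) = g (i', j')"
    unfolding inj_on_def by auto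
  define d e where "d = int i - int i'" and "e = int j - int j'"
  have bd: "\<bar>d\<bar> \<le> int K" "\<bar>e\<bar> \<le> int K" using ij by (auto simp: A_def d_def e_def)
  have de: "d \<noteq> 0 \<or> e \<noteq> 0" using ij by (auto simp: d_def e_def)
  have dvd: "int q dvd y * d - e"
    using ij(4) by (simp add: g_def mod_eq_dvd_iff d_def e_def algebra_simps)
  have small: "z = 0" if "int q dvd z" "\<bar>z\<bar> \<le> int K" for z
    using that Kq zdvd_imp_le[of "int q" "\<bar>z\<bar>"] by fastforce
  \<comment> \<open>If \<open>d = 0\<close>, then \<open>q\<close> divides \<open>e\<close>, so
    \<open>e = 0\<close> by size and the two pairs would coincide. The converse case needs
    \<open>y\<close> to be invertible modulo \<open>q\<close>.\<close>
  have d0: "d \<noteq> 0" using de dvd small[of e] bd by auto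
  have e0: "e \<noteq> 0"
  proof
    assume "e = 0"
    then have "int q dvd d" using dvd y
      by (simp add: coprime_commute coprime_dvd_mult_right_iff)
    then show False using small bd d0 by blast
  qed
  have "int q dvd (y * d - e) * (y * d + e)" using dvd by simp
  then have "[y\<^sup>2 * d\<^sup>2 = e\<^sup>2] (mod int q)"
    by (simp add: cong_iff_dvd_diff algebra_simps power2_eq_square)
  then have c: "[y\<^sup>2 * (int (nat \<bar>d\<bar>))\<^sup>2 = (int (nat \<bar>e\<bar>))\<^sup>2] (mod int q)" by simp
  have "nat \<bar>d\<bar> * nat \<bar>d\<bar> \<le> K * K" "nat \<bar>e\<bar> * nat \<bar>e\<bar> \<le> K * K"
    using bd by (auto intro!: mult_le_mono)
  then show ?thesis using that[of "nat \<bar>e\<bar>" "nat \<bar>d\<bar>"] c KK d0 e0 by simp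
qed

text \<open>Let \<open>p\<close> be a prime factor of \<open>q - 4 * s\<close>, where
  \<open>s = (-1) ^ k\<close>. Then \<open>q\<close> is \<open>4 * s\<close> modulo
  \<open>p\<close>, and since 4 is a square, the Legendre symbol of \<open>q\<close> over
  \<open>p\<close> is \<open>s ^ h\<close>. The reciprocity sign \<open>(-1) ^ (h * k)\<close> is
  the same \<open>s ^ h\<close>, so the symbol of \<open>p\<close> over \<open>q\<close> is
  1.\<close>

lemma prime_quadratic_residue_exists:
  fixes q :: nat
  assumes q: "prime q" and q7: "q \<ge> 7"
  obtains p :: nat where "prime p" "p \<noteq> q" "p \<le> q + 4" "QuadRes (int q) (int p)"
proof -
  define k where "k = (q - 1) div 2"
  define s :: int where "s = (-1) ^ k"
  have s: "s = 1 \<or> s = -1" by (simp add: s_def minus_one_power_iff)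
  have oq: "odd q" using q q7 prime_odd_nat by simp
  define N where "N = nat (int q - 4 * s)"
  have N: "int N = int q - 4 * s" using s q7 by (auto simp: N_def)
  have "odd (int N)" using N oq by simp
  then have oN: "odd N" by simp
  \<comment> \<open>The bound \<open>q \<ge> 7\<close> matters here: \<open>q = 5\<close> would give
    \<open>N = 1\<close>, which has no prime factor.\<close>
  have "N \<noteq> 1" "N > 0" "N \<le> q + 4" using N s q7 by auto
  then obtain p where p: "prime p" "p dvd N" by (meson prime_factor_nat)
  have pdvd: "int p dvd int q - 4 * s" using p N by (metis int_dvd_int_iff)
  have "p \<noteq> 2" using p oN by blast
  then have p2: "p > 2" using p prime_ge_2_nat[of p] by linarith
  have pq: "p \<noteq> q"
  proof
    assume "p = q"
    then have "int q dvd 4 * s" using pdvd by (metis dvd_refl dvd_diff_right_iff)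
    then have "int q dvd 4" using s by auto
    then show False using q7 zdvd_imp_le[of "int q" 4] by simp
  qed
  have ple: "p \<le> q + 4" using dvd_imp_le[OF p(2) \<open>N > 0\<close>] \<open>N \<le> q + 4\<close> by linarith
  define h where "h = (p - 1) div 2"
  have op: "odd p" using p p2 prime_odd_nat by simp
  have h2: "2 * h = p - 1" using op by (auto simp: h_def elim: oddE)
  have "[int q = 4 * s] (mod int p)" using pdvd by (simp add: cong_iff_dvd_diff)
  then have "[int q ^ h = (4 * s) ^ h] (mod int p)" by (rule cong_pow)
  \<comment> \<open>The square 4 contributes \<open>4 ^ h = 2 ^ (p - 1)\<close>, which is 1 modulo
    \<open>p\<close> by Fermat's little theorem.\<close>
  moreover have "(4 * s) ^ h = 2 ^ (p - 1) * s ^ h"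
    unfolding h2[symmetric] by (simp add: power_mult_distrib power_mult)
  moreover have "[(2::int) ^ (p - 1) = 1] (mod int p)"
  proof -
    have "\<not> p dvd 2" using p2 by (auto dest: dvd_imp_le)
    then have "[2 ^ (p - 1) = (1::nat)] (mod p)" using fermat_theorem p(1) by blast
    then show ?thesis by (metis cong_int_iff of_nat_1 of_nat_numeral of_nat_power)
  qed
  ultimately have qh: "[int q ^ h = s ^ h] (mod int p)"
    by (metis cong_scalar_right cong_trans mult_1)
  have "[Legendre (int q) (int p) = int q ^ h] (mod int p)"
    using euler_criterion[of p "int q"] p p2 by (simp add: h_def)
  with qh have "[Legendre (int q) (int p) = s ^ h] (mod int p)" using cong_trans by blast
  moreover have sh: "s ^ h = 1 \<or> s ^ h = -1"
    using s by (auto simp: minus_one_power_iff split: if_splits)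
  \<comment> \<open>As \<open>p > 2\<close>, the values -1, 0 and 1 are distinct modulo
    \<open>p\<close>, so the congruence becomes an equality.\<close>
  moreover have "\<not> int p dvd 1" "\<not> int p dvd 2" "\<not> int p dvd -1" "\<not> int p dvd -2"
    using p2 by (auto dest: zdvd_imp_le)
  ultimately have L: "Legendre (int q) (int p) = s ^ h"
    by (auto simp: Legendre_def cong_iff_dvd_diff split: if_splits)
  have "Legendre (int p) (int q) * Legendre (int q) (int p) = (-1) ^ (h * k)"
    using Quadratic_Reciprocity[of p q] p q p2 q7 pq by (simp add: h_def k_def)
  then have "Legendre (int p) (int q) * s ^ h = s ^ h"
    by (simp add: L s_def power_mult[symmetric] mult.commute)
  then have "Legendre (int p) (int q) = 1" using s by auto
  then have "QuadRes (int q) (int p)" by (auto simp: Legendre_def split: if_splits)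
  then show ?thesis using that p pq ple by blast
qed

text \<open>By complete multiplicativity, a common factor \<open>b\<close> preserves the
  disagreement between \<open>m\<close> and \<open>m'\<close>. Taking \<open>b\<close> to be the
  least residue of \<open>a\<close> times the inverse of \<open>m\<close> costs at most a factor
  \<open>q\<close> in size.\<close>

lemma liouville_lambda_differs_on_class:
  fixes q :: nat and a :: int
  assumes q: "prime q" and a: "coprime a (int q)"
    and m: "m > 0" "m' > 0" "\<not> q dvd m" "[m = m'] (mod q)"
    and ne: "liouville_lambda m \<noteq> liouville_lambda m'"
    and bd: "real m \<le> X" "real m' \<le> X"
  obtains n n' :: nat where "n > 0" "n' > 0" "[int n = a] (mod int q)" "[int n' = a] (mod int q)"
    "real n \<le> real q * X" "real n' \<le> real q * X" "liouville_lambda n = -1" "liouville_lambda n' = 1"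
proof -
  have q0: "q > 0" using q prime_gt_0_nat by blast
  have "coprime m q" using prime_imp_coprime[OF q m(3)] by (simp add: coprime_commute)
  then obtain x where x: "[int m * x = 1] (mod int q)"
    using cong_solve_coprime_int by (metis coprime_int_iff)
  define b where "b = nat ((a * x) mod int q)"
  have b: "int b = (a * x) mod int q" using q0 by (simp add: b_def)
  have bm: "[int (b * m) = a] (mod int q)"
  proof -
    have "[int b * int m = (a * x) * int m] (mod int q)" using b by (intro cong_mult) (auto simp: cong_def)
    also have "(a * x) * int m = a * (int m * x)" by simp
    also have "[a * (int m * x) = a * 1] (mod int q)" using x by (intro cong_mult) auto
    finally show ?thesis by simp
  qed
  have bm': "[int (b * m') = a] (mod int q)"
    using bm m(4) by (metis cong_int_iff cong_scalar_left cong_sym cong_trans)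
  have b0: "b > 0"
  proof (rule ccontr)
    assume "\<not> b > 0"
    then have "int q dvd a" using bm by (simp add: cong_dvd_iff[OF bm, symmetric])
    with a have "is_unit (int q)" by (meson coprime_common_divisor dvd_refl)
    then show False using q by auto
  qed
  have "int b < int q" using b q0 by simp
  then have bq: "real b \<le> real q" by simp
  have le: "real (b * m) \<le> real q * X" "real (b * m') \<le> real q * X"
    using bq bd by (auto intro!: mult_mono)
  have "liouville_lambda (b * m) \<noteq> liouville_lambda (b * m')"
    using ne b0 m liouville_lambda_cases[of b] by (auto simp: liouville_lambda_mult)
  \<comment> \<open>Which of the two multiples has value -1 is unknown, so both assignments are
    offered.\<close>
  then show ?thesis
    using that[of "b * m" "b * m'"] that[of "b * m'" "b * m"] bm bm' le b0 m
      liouville_lambda_cases[of "b * m"] liouville_lambda_cases[of "b * m'"] by auto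
qed

text \<open>In the bound, the first \<open>q\<close> pays for the move into the class of
  \<open>a\<close>, \<open>q + 4\<close> bounds \<open>p\<close> and \<open>w\<close>, and
  \<open>sqrt q\<close> bounds \<open>v\<close>.\<close>

lemma liouville_lambda_both_signs:
  fixes q :: nat and a :: int
  assumes q: "prime q" and q7: "q \<ge> 7" and a: "coprime a (int q)"
  obtains n n' :: nat where "n > 0" "n' > 0" "[int n = a] (mod int q)" "[int n' = a] (mod int q)"
    "real n \<le> real q * (real (q + 4) * sqrt (real q))"
    "real n' \<le> real q * (real (q + 4) * sqrt (real q))"
    "liouville_lambda n = -1" "liouville_lambda n' = 1"
proof -
  obtain p where p: "prime p" "p \<noteq> q" "p \<le> q + 4" "QuadRes (int q) (int p)"
    using prime_quadratic_residue_exists[OF q q7] .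
  then obtain y where y: "[y\<^sup>2 = int p] (mod int q)" unfolding QuadRes_def by blast
  have "\<not> q dvd p" using p q primes_dvd_imp_eq by blast
  then have "\<not> int q dvd int p" by simp
  then have "\<not> int q dvd y\<^sup>2" using y by (metis cong_dvd_iff)
  then have "\<not> int q dvd y" by (auto simp: power2_eq_square)
  then have "coprime y (int q)"
    using q prime_imp_coprime[of "int q" y] by (simp add: coprime_commute)
  then obtain u v where uv: "u > 0" "v > 0" "u * u \<le> q" "v * v \<le> q"
    "[y\<^sup>2 * (int v)\<^sup>2 = (int u)\<^sup>2] (mod int q)" using thue_squares[OF q] by blast
  have nd: "\<not> q dvd z" if "z > 0" "z * z \<le> q" for z
  proof
    assume "q dvd z"
    then have "q \<le> z" using that dvd_imp_le by blast
    then have "q * q \<le> q" using that mult_le_mono le_trans by blast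
    then show False using q7 by simp
  qed
  have "[int p * (int v)\<^sup>2 = y\<^sup>2 * (int v)\<^sup>2] (mod int q)" using y cong_scalar_right cong_sym by blast
  then have "[int (p * v * v) = int (u * u)] (mod int q)"
    using uv(5) cong_trans by (fastforce simp: power2_eq_square mult.assoc)
  then have pvv: "[p * v * v = u * u] (mod q)" using cong_int_iff by blast
  \<comment> \<open>Reducing before the second multiplication by \<open>v\<close> keeps
    \<open>w * v\<close> below \<open>q * sqrt q\<close>; for \<open>p * v * v\<close> itself the
    available bound is only \<open>(q + 4) * q\<close>.\<close>
  define w where "w = p * v mod q"
  have pv: "\<not> q dvd p * v" using \<open>\<not> q dvd p\<close> nd uv q prime_dvd_mult_iff by blast
  then have w: "w > 0" "w < q" using q7 by (auto simp: w_def dvd_eq_mod_eq_0)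
  have cw: "[p * v = w] (mod q)" by (simp add: w_def cong_def)
  have cu: "[u * u = w * v] (mod q)" using pvv cw by (metis cong_scalar_right cong_sym cong_trans)
  have uu: "\<not> q dvd u * u" using nd uv q prime_dvd_mult_iff by blast
  let ?X = "real (q + 4) * sqrt (real q)"
  have "real v * real v \<le> real q" using uv(4) by (metis of_nat_le_iff of_nat_mult)
  then have vs: "real v \<le> sqrt (real q)" by (simp add: real_le_rsqrt power2_eq_square)
  have s1: "sqrt (real q) \<ge> 1" using q7 by simp
  have "real w * 1 \<le> ?X" using w s1 by (intro mult_mono) auto
  then have X2: "real w \<le> ?X" by simp
  have X1: "real (p * v) \<le> ?X" unfolding of_nat_mult using p vs by (intro mult_mono) auto
  have X3: "real (w * v) \<le> ?X" unfolding of_nat_mult using w vs by (intro mult_mono) auto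
  have "real (u * u) * 1 \<le> ?X"
    using uv(3) s1 by (intro mult_mono) (auto simp del: of_nat_mult)
  then have X4: "real (u * u) \<le> ?X" by simp
  have p0: "p > 0" using p prime_gt_0_nat by blast
  show ?thesis
  proof (cases "liouville_lambda (p * v) = liouville_lambda w")
    case False
    show ?thesis
      by (rule liouville_lambda_differs_on_class[OF q a _ _ pv cw False X1 X2])
        (use p0 uv w that in auto)
  next
    case True
    then have "liouville_lambda w = - liouville_lambda v"
      using p uv p0 by (simp add: liouville_lambda_mult liouville_lambda_prime)
    \<comment> \<open>The square \<open>u * u\<close> has value 1, while \<open>w * v\<close> has
      minus the square of the value at \<open>v\<close>, that is -1.\<close>
    then have F: "liouville_lambda (u * u) \<noteq> liouville_lambda (w * v)"
      using uv w liouville_lambda_square[of u] liouville_lambda_square[of v]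
      by (simp add: liouville_lambda_mult)
    show ?thesis
      by (rule liouville_lambda_differs_on_class[OF q a _ _ uu cu F X4 X3])
        (use uv w that in auto)
  qed
qed

theorem theorem1:
  fixes \<epsilon> :: real
  assumes "\<epsilon> > 0"
  shows "\<exists>q0::nat. \<forall>q::nat. prime q \<and> q \<ge> q0 \<longrightarrow>
    (\<forall>a::int. coprime a (int q) \<longrightarrow>
      (\<exists>n m :: nat. n > 0 \<and> m > 0 \<and>
        real n \<le> real q powr (5/2 + \<epsilon>) \<and> real m \<le> real q powr (5/2 + \<epsilon>) \<and>
        [int n = a] (mod int q) \<and> [int m = a] (mod int q) \<and>
        liouville_lambda n = -1 \<and> liouville_lambda m = 1))"
proof (rule exI[of _ "max 7 (nat \<lceil>2 powr (1 / \<epsilon>)\<rceil>)"], intro allI impI)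
  let ?q0 = "max 7 (nat \<lceil>2 powr (1 / \<epsilon>)\<rceil>)"
  fix q :: nat and a :: int
  assume q: "prime q \<and> ?q0 \<le> q" and a: "coprime a (int q)"
  then have q7: "q \<ge> 7" by simp
  \<comment> \<open>The threshold makes \<open>q powr \<epsilon>\<close> at least 2, which absorbs
    the constant in \<open>q + 4 \<le> 2 * q\<close>.\<close>
  have "2 powr (1 / \<epsilon>) \<le> real q" using q by linarith
  then have "(2 powr (1 / \<epsilon>)) powr \<epsilon> \<le> real q powr \<epsilon>" using assms by (intro powr_mono2) auto
  then have q2: "2 \<le> real q powr \<epsilon>" using assms by (simp add: powr_powr)
  have "real q * (real (q + 4) * sqrt (real q)) \<le> real q * ((real q * 2) * sqrt (real q))"
    using q7 by (intro mult_left_mono mult_right_mono) auto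
  also have "\<dots> \<le> real q * ((real q * real q powr \<epsilon>) * sqrt (real q))"
    using q2 by (intro mult_left_mono mult_right_mono) auto
  also have "\<dots> = real q powr 1 * real q powr 1 * real q powr (1/2) * real q powr \<epsilon>"
    using q7 by (simp add: powr_half_sqrt)
  also have "\<dots> = real q powr (5/2 + \<epsilon>)"
    by (simp only: powr_add[symmetric]) simp
  finally have le: "real q * (real (q + 4) * sqrt (real q)) \<le> real q powr (5/2 + \<epsilon>)" .
  obtain n m where "n > 0" "m > 0" "[int n = a] (mod int q)" "[int m = a] (mod int q)"
    "real n \<le> real q * (real (q + 4) * sqrt (real q))"
    "real m \<le> real q * (real (q + 4) * sqrt (real q))"
    "liouville_lambda n = -1" "liouville_lambda m = 1"
    using liouville_lambda_both_signs[OF _ q7 a] q by blast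
  with le show "\<exists>n m :: nat. n > 0 \<and> m > 0 \<and>
        real n \<le> real q powr (5/2 + \<epsilon>) \<and> real m \<le> real q powr (5/2 + \<epsilon>) \<and>
        [int n = a] (mod int q) \<and> [int m = a] (mod int q) \<and>
        liouville_lambda n = -1 \<and> liouville_lambda m = 1"
    by (meson order_trans)
qed

end
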